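(* Let $c$, $k$ and $t$ be positive integers with $c\ge 3$ and $k\ge t+2$. Suppose $\mathcal{F}$ and $\mathcal{G}$ are non-empty cross $t$-intersecting subfamilies of $U^{[ck]}_{c,k}$ such that $|\mathcal{F}|\le|\mathcal{G}|$ and $|\mathcal{F}|+|\mathcal{G}|$ is maximum among all such pairs. If $c\ge 3+2\log_2 t$ or $k\ge 2t+2$, then $\mathcal{F}=\{C\}$ and $\mathcal{G}=\{F\in U^{[ck]}_{c,k}: |F\cap C|\ge t\}$ for some $C\in U^{[ck]}_{c,k}$.
   Context: For positive integers $c,k,\ell$, $U^{[ck]}_{c,\ell}$ denotes the set of all families of $\ell$ pairwise disjoint $c$-subsets ("blocks") of $[ck]$; $U^{[ck]}_{c,k}$ is the set of $c$-uniform partitions of $[ck]$. For such families $A,B$, $A\cap B$ denotes the set of common blocks. Families $\mathcal{A},\mathcal{B}$ are cross $t$-intersecting if $|A\cap B|\ge t$ for all $A\in\mathcal{A}$, $B\in\mathcal{B}$. *)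

theory Defs
  imports Complex_Main
begin

definition uniform_families :: "'a set \<Rightarrow> nat \<Rightarrow> nat \<Rightarrow> 'a set set set" where
  "uniform_families X c l =
     {A. A \<subseteq> Pow X \<and> card A = l \<and> (\<forall>b\<in>A. card b = c) \<and> pairwise disjnt A}"

definition uniform_partitions :: "nat \<Rightarrow> nat \<Rightarrow> nat set set set" where
  "uniform_partitions c k = uniform_families {1..c * k} c k"

definition cross_t_intersecting :: "nat \<Rightarrow> 'a set set set \<Rightarrow> 'a set set set \<Rightarrow> bool" where
  "cross_t_intersecting t \<A> \<B> \<longleftrightarrow> (\<forall>A\<in>\<A>. \<forall>B\<in>\<B>. card (A \<inter> B) \<ge> t)"

definition nonempty_cross_pair ::
    "nat \<Rightarrow> nat \<Rightarrow> nat \<Rightarrow> nat set set set \<Rightarrow> nat set set set \<Rightarrow> bool" where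
  "nonempty_cross_pair c k t \<F> \<G> \<longleftrightarrow>
     \<F> \<subseteq> uniform_partitions c k \<and> \<G> \<subseteq> uniform_partitions c k \<and>
     \<F> \<noteq> {} \<and> \<G> \<noteq> {} \<and> cross_t_intersecting t \<F> \<G>"

end

theory Submission
  imports Defs
begin

text \<open>Write \<open>u j\<close> for the number of partitions of a \<open>c * j\<close>-set into \<open>c\<close>-blocks and put \<open>m = k - t\<close>,
  \<open>K = k choose t\<close>. The partitions sharing at least \<open>t\<close> blocks with a given \<open>C\<close> number at least
  \<open>K * (u m - m * u (m - 1))\<close>. Suppose \<open>\<F>\<close> contains \<open>A \<noteq> B\<close> with \<open>s\<close> common blocks, so \<open>s \<le> k - 2\<close>.
  Every member of \<open>\<G>\<close> contains some \<open>t\<close>-subset \<open>T\<close> of \<open>A\<close>; the \<open>s choose t\<close> choices inside \<open>B\<close> are in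
  at most \<open>u m\<close> members each, the others in at most \<open>m * u (m - 1)\<close>, and \<open>u m\<close> is much larger than
  \<open>m * u (m - 1)\<close>. If \<open>s \<le> t\<close> for some pair, then \<open>|\<F>| + |\<G>| \<le> 2 |\<G>|\<close> is already too small. Otherwise
  all of \<open>\<F>\<close> shares \<open>t + 1\<close> blocks with \<open>A\<close>, so \<open>|\<F>| \<le> (k choose (t + 1)) * u (m - 1)\<close> is negligible
  against the loss in \<open>|\<G>|\<close> caused by \<open>s \<le> k - 2\<close>. Hence \<open>\<F>\<close> is a singleton.\<close>

section \<open>Counting uniform partitions\<close>

text \<open>The recursion picks the block of a fixed point, so for \<open>c > 0\<close> the value is
  (c j)! / (c!^j j!). This form exposes the ratio of consecutive values, on which the estimates
  rest.\<close>

fun num_partitions :: "nat \<Rightarrow> nat \<Rightarrow> nat" where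
  "num_partitions c 0 = 1"
| "num_partitions c (Suc j) = ((c * Suc j - 1) choose (c - 1)) * num_partitions c j"

lemma finite_uniform_families: "finite X \<Longrightarrow> finite (uniform_families X c l)"
  by (rule finite_subset[of _ "Pow (Pow X)"]) (auto simp: uniform_families_def)

lemma card_Union_uniform_family:
  assumes "finite X" "T \<in> uniform_families X c t"
  shows "card (\<Union>T) = c * t"
proof -
  have T: "T \<subseteq> Pow X" "card T = t" "\<And>b. b \<in> T \<Longrightarrow> card b = c" "pairwise disjnt T"
    using assms(2) by (auto simp: uniform_families_def)
  have "card (\<Union>T) = (\<Sum>b\<in>T. card b)"
    using T assms(1) by (intro card_Union_disjoint) (auto intro: finite_subset)
  then show ?thesis using T by simp
qed

text \<open>\<open>uniform_families\<close> does not ask for covering; \<open>k\<close> disjoint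
  blocks of size \<open>c\<close> already exhaust \<open>c * k\<close> points.\<close>

lemma Union_uniform_partition:
  assumes "finite X" "card X = c * k" "A \<in> uniform_families X c k"
  shows "\<Union>A = X"
proof (rule card_subset_eq)
  show "\<Union>A \<subseteq> X" using assms(3) by (auto simp: uniform_families_def)
qed (use assms card_Union_uniform_family in auto)

lemma uniform_families_subset:
  assumes "A \<in> uniform_families X c k" "T \<subseteq> A"
  shows "T \<in> uniform_families X c (card T)"
  using assms by (auto simp: uniform_families_def intro: pairwise_subset)

text \<open>The inverse adds \<open>T\<close> back: blocks outside \<open>\<Union>T\<close> are
  automatically disjoint from those of \<open>T\<close>.\<close>

lemma bij_betw_remove_subfamily:
  assumes "finite X" "c > 0" "T \<in> uniform_families X c t" "t \<le> k"
  shows "bij_betw (\<lambda>G. G - T) {G \<in> uniform_families X c k. T \<subseteq> G}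
           (uniform_families (X - \<Union>T) c (k - t))"
proof (rule bij_betw_byWitness[where f' = "\<lambda>H. H \<union> T"])
  have T: "T \<subseteq> Pow X" "card T = t" "\<And>b. b \<in> T \<Longrightarrow> card b = c" "pairwise disjnt T"
    using assms(3) by (auto simp: uniform_families_def)
  have fT: "finite T" using T(1) assms(1) by (meson finite_Pow_iff finite_subset)
  \<comment> \<open>The empty set is disjoint from itself and could lie in both \<open>H\<close> and
    \<open>T\<close>; \<open>c > 0\<close> excludes it.\<close>
  have disj: "H \<inter> T = {}" if H: "H \<in> uniform_families (X - \<Union>T) c j" for H j
  proof -
    have False if "b \<in> H" "b \<in> T" for b
    proof -
      have "b \<subseteq> X - \<Union>T" "b \<subseteq> \<Union>T" using that H by (auto simp: uniform_families_def)
      then have "b = {}" by blast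
      then show False using T(3)[OF \<open>b \<in> T\<close>] assms(2) by simp
    qed
    then show ?thesis by blast
  qed
  show "\<forall>G\<in>{G \<in> uniform_families X c k. T \<subseteq> G}. G - T \<union> T = G" by auto
  show "\<forall>H\<in>uniform_families (X - \<Union>T) c (k - t). H \<union> T - T = H" using disj by blast
  show "(\<lambda>G. G - T) ` {G \<in> uniform_families X c k. T \<subseteq> G} \<subseteq> uniform_families (X - \<Union>T) c (k - t)"
  proof (clarify)
    fix G assume G: "G \<in> uniform_families X c k" "T \<subseteq> G"
    have pw: "pairwise disjnt G" using G by (auto simp: uniform_families_def)
    have "card (G - T) = k - t" using G fT T by (simp add: card_Diff_subset uniform_families_def)
    moreover have "b \<subseteq> X - \<Union>T" if b: "b \<in> G - T" for b
    proof -
      have "disjnt b a" if "a \<in> T" for a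
        using pairwiseD[OF pw, of b a] b G(2) that by blast
      moreover have "b \<subseteq> X" using b G by (auto simp: uniform_families_def)
      ultimately show ?thesis by (auto simp: disjnt_def)
    qed
    ultimately show "G - T \<in> uniform_families (X - \<Union>T) c (k - t)"
      using G pairwise_subset[OF pw, of "G - T"] by (auto simp: uniform_families_def)
  qed
  show "(\<lambda>H. H \<union> T) ` uniform_families (X - \<Union>T) c (k - t) \<subseteq> {G \<in> uniform_families X c k. T \<subseteq> G}"
  proof (clarify, intro conjI)
    fix H assume H: "H \<in> uniform_families (X - \<Union>T) c (k - t)"
    have H': "H \<subseteq> Pow (X - \<Union>T)" "card H = k - t" "\<forall>b\<in>H. card b = c" "pairwise disjnt H"
      using H by (auto simp: uniform_families_def)
    have "finite H" using H'(1) assms(1) by (meson finite_Diff finite_Pow_iff finite_subset)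
    then have "card (H \<union> T) = k" using fT disj[OF H] H' T assms(4) by (simp add: card_Un_disjoint)
    moreover have "pairwise disjnt (H \<union> T)"
    proof (rule pairwiseI)
      fix a b assume ab: "a \<in> H \<union> T" "b \<in> H \<union> T" "a \<noteq> b"
      have cross: "disjnt x y" if "x \<in> H" "y \<in> T" for x y
        using that H'(1) by (auto simp: disjnt_def)
      show "disjnt a b"
        using ab cross[of a b] cross[of b a] pairwiseD[OF H'(4), of a b] pairwiseD[OF T(4), of a b]
        by (auto simp: disjnt_sym)
    qed
    ultimately show "H \<union> T \<in> uniform_families X c k"
      using H' T by (auto simp: uniform_families_def)
  qed auto
qed

text \<open>Induction on \<open>j\<close>: classify the partitions by the block through a fixed
  point \<open>x\<close>; removing it leaves a partition of \<open>c * j\<close> points.\<close>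

lemma card_uniform_partitions:
  assumes "finite X" "c > 0" "card X = c * j"
  shows "card (uniform_families X c j) = num_partitions c j"
  using assms(1,3)
proof (induction j arbitrary: X)
  case 0
  have "A = {}" if "A \<in> uniform_families X c 0" for A
    using that 0 finite_subset[of A "Pow X"] by (auto simp: uniform_families_def)
  moreover have "{} \<in> uniform_families X c 0" by (simp add: uniform_families_def)
  ultimately have "uniform_families X c 0 = {{}}" by blast
  then show ?case by simp
next
  case (Suc j)
  then obtain x where x: "x \<in> X" using assms(2) by fastforce
  define S where "S = {b. b \<subseteq> X \<and> card b = c \<and> x \<in> b}"
  define Q where "Q b = {G \<in> uniform_families X c (Suc j). {b} \<subseteq> G}" for b
  have fS: "finite S" unfolding S_def using Suc.prems by simp
  have "bij_betw (\<lambda>b. b - {x}) S {d. d \<subseteq> X - {x} \<and> card d = c - 1}"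
  proof (rule bij_betw_byWitness[where f' = "insert x"])
    show "(\<lambda>b. b - {x}) ` S \<subseteq> {d. d \<subseteq> X - {x} \<and> card d = c - 1}"
      by (auto simp: S_def card_Diff_singleton)
    show "insert x ` {d. d \<subseteq> X - {x} \<and> card d = c - 1} \<subseteq> S"
    proof clarify
      fix d assume d: "d \<subseteq> X - {x}" "card d = c - 1"
      then have "finite d" "x \<notin> d" using Suc.prems(1) finite_subset by blast+
      then show "insert x d \<in> S" using d x assms(2) by (auto simp: S_def)
    qed
  qed (auto simp: S_def)
  then have cS: "card S = (c * Suc j - 1) choose (c - 1)"
    using Suc.prems x by (simp add: bij_betw_same_card n_subsets)
  have cQ: "card (Q b) = num_partitions c j" if "b \<in> S" for b
  proof -
    have b: "{b} \<in> uniform_families X c 1"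
      using that by (auto simp: uniform_families_def S_def)
    have "card (Q b) = card (uniform_families (X - \<Union>{b}) c (Suc j - 1))"
      unfolding Q_def
      by (intro bij_betw_same_card[OF bij_betw_remove_subfamily[OF Suc.prems(1) assms(2) b]]) simp
    also have "\<dots> = num_partitions c j"
    proof -
      have "b \<subseteq> X" "card b = c" using that by (auto simp: S_def)
      then have "card (X - b) = c * j"
        using Suc.prems by (simp add: card_Diff_subset finite_subset)
      then show ?thesis using Suc.IH[of "X - b"] Suc.prems(1) by simp
    qed
    finally show ?thesis .
  qed
  have "uniform_families X c (Suc j) = (\<Union>b\<in>S. Q b)"
  proof
    show "uniform_families X c (Suc j) \<subseteq> (\<Union>b\<in>S. Q b)"
    proof
      fix G assume G: "G \<in> uniform_families X c (Suc j)"
      have "x \<in> \<Union>G" using Union_uniform_partition[OF Suc.prems G] x by simp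
      then obtain b where "b \<in> G" "x \<in> b" by blast
      then show "G \<in> (\<Union>b\<in>S. Q b)" using G by (auto simp: Q_def S_def uniform_families_def)
    qed
  qed (auto simp: Q_def)
  also have "card \<dots> = (\<Sum>b\<in>S. card (Q b))"
  proof (rule card_UN_disjoint[OF fS])
    show "\<forall>b\<in>S. finite (Q b)"
      using finite_uniform_families[OF Suc.prems(1)] by (simp add: Q_def)
    show "\<forall>a\<in>S. \<forall>b\<in>S. a \<noteq> b \<longrightarrow> Q a \<inter> Q b = {}"
    proof (intro ballI impI)
      fix a b assume ab: "a \<in> S" "b \<in> S" "a \<noteq> b"
      have False if "G \<in> Q a" "G \<in> Q b" for G
      proof -
        have "pairwise disjnt G" "a \<in> G" "b \<in> G" using that by (auto simp: Q_def uniform_families_def)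
        then have "disjnt a b" using ab by (meson pairwiseD)
        then show False using ab by (auto simp: S_def disjnt_def)
      qed
      then show "Q a \<inter> Q b = {}" by blast
    qed
  qed
  also have "\<dots> = num_partitions c (Suc j)" using cQ cS by simp
  finally show ?case .
qed

lemma card_partitions_containing:
  assumes "finite X" "c > 0" "card X = c * k" "T \<in> uniform_families X c t" "t \<le> k"
  shows "card {G \<in> uniform_families X c k. T \<subseteq> G} = num_partitions c (k - t)"
proof -
  have "\<Union>T \<subseteq> X" using assms(4) by (auto simp: uniform_families_def)
  then have "card (X - \<Union>T) = c * (k - t)"
    using card_Union_uniform_family[OF assms(1,4)] assms(1,3)
    by (simp add: card_Diff_subset finite_subset diff_mult_distrib2)
  then show ?thesis
    using bij_betw_same_card[OF bij_betw_remove_subfamily[OF assms(1,2,4,5)]]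
      card_uniform_partitions[of "X - \<Union>T" c "k - t"] assms(1,2) by simp
qed

section \<open>Growth of the number of partitions\<close>

text \<open>Induction on \<open>c\<close> from 3: by Pascal's rule both entries may be raised by
  one, and the upper one then grows to \<open>Suc c * m - 1\<close>.\<close>

lemma choose_block_mono:
  assumes "c \<ge> 3" "m \<ge> 1"
  shows "(3 * m - 1) choose 2 \<le> (c * m - 1) choose (c - 1)"
  using assms(1)
proof (induction c rule: dec_induct)
  case base
  then show ?case by simp
next
  case (step c)
  have cm: "c * m = Suc (c * m - 1)" "c = Suc (c - 1)" using step.hyps assms(2) by auto
  have "(c * m - 1) choose (c - 1) \<le> (c * m) choose c"
    by (subst (2) cm(1), subst (3) cm(2)) simp
  also have "\<dots> \<le> (Suc c * m - 1) choose c"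
    using assms(2) by (intro binomial_right_mono) auto
  finally show ?case using step.IH by simp
qed

text \<open>\<open>B\<close> counts the blocks through a fixed point; its lower bound comes from
  \<open>c = 3\<close> and is quadratic in \<open>m\<close>.\<close>

lemma num_partitions_growth:
  assumes "c \<ge> 3" "m \<ge> 1"
  obtains B where "num_partitions c m = B * num_partitions c (m - 1)"
    "2 * B \<ge> (3 * m - 1) * (3 * m - 2)"
proof
  show "num_partitions c m = ((c * m - 1) choose (c - 1)) * num_partitions c (m - 1)"
    using assms(2) by (cases m) auto
  have "2 * ((3 * m - 1) choose 2) = (3 * m - 1) * (3 * m - 1 - 1)"
    by (simp add: choose_two)
  then have "2 * ((3 * m - 1) choose 2) = (3 * m - 1) * (3 * m - 2)"
    by (simp add: numeral_2_eq_2)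
  then show "2 * ((c * m - 1) choose (c - 1)) \<ge> (3 * m - 1) * (3 * m - 2)"
    using choose_block_mono[OF assms] by linarith
qed

section \<open>Partitions of a fixed ground set\<close>

locale partition_setting =
  fixes X :: "'a set" and c k :: nat
  assumes finX: "finite X" and cpos: "c > 0" and cardX: "card X = c * k"
begin

abbreviation "P \<equiv> uniform_families X c k"

lemma finP: "finite P"
  by (rule finite_uniform_families[OF finX])

lemma partition_card: "A \<in> P \<Longrightarrow> card A = k"
  by (simp add: uniform_families_def)

lemma partition_finite: "A \<in> P \<Longrightarrow> finite A"
  using finX by (auto simp: uniform_families_def intro: finite_subset[of _ "Pow X"])

lemma card_containing:
  assumes "A \<in> P" "W \<subseteq> A"
  shows "card {G \<in> P. W \<subseteq> G} = num_partitions c (k - card W)"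
  using card_partitions_containing[OF finX cpos cardX uniform_families_subset[OF assms]]
    card_mono[OF partition_finite[OF assms(1)] assms(2)] partition_card[OF assms(1)] by simp

lemma card_containing_le: "card {G \<in> P. W \<subseteq> G} \<le> num_partitions c (k - card W)"
proof (cases "{G \<in> P. W \<subseteq> G} = {}")
  case False
  then show ?thesis using card_containing by fastforce
qed (simp only: card.empty)

text \<open>Once \<open>k - 1\<close> blocks are fixed, the remaining \<open>c\<close> points must
  form the last one.\<close>

lemma card_common_blocks:
  assumes "A \<in> P" "B \<in> P" "A \<noteq> B"
  shows "card (A \<inter> B) + 2 \<le> k"
proof (rule ccontr)
  assume "\<not> ?thesis"
  then have "k - 1 \<le> card (A \<inter> B)" by simp
  then obtain W where W: "W \<subseteq> A \<inter> B" "card W = k - 1"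
    by (meson obtain_subset_with_card_n)
  have "k \<noteq> 0" using assms partition_card[of A] partition_card[of B]
      partition_finite[of A] partition_finite[of B] by auto
  then have "card {G \<in> P. W \<subseteq> G} = 1"
    using card_containing[of A W] W assms by simp
  moreover have "A \<in> {G \<in> P. W \<subseteq> G}" "B \<in> {G \<in> P. W \<subseteq> G}" using assms W by auto
  ultimately show False using assms(3) by (metis card_1_singletonE singletonD)
qed

lemma card_t_subfamilies: "A \<in> P \<Longrightarrow> card {T. T \<subseteq> A \<and> card T = t} = k choose t"
  by (simp add: n_subsets partition_finite partition_card)

lemma finite_t_subfamilies: "A \<in> P \<Longrightarrow> finite {T. T \<subseteq> A \<and> card T = t}"
  by (simp add: partition_finite)

section \<open>Partitions sharing many blocks\<close>

lemma card_neighbourhood_le: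
  assumes "A \<in> P"
  shows "card {G \<in> P. t \<le> card (G \<inter> A)} \<le> (k choose t) * num_partitions c (k - t)"
proof -
  let ?I = "{T. T \<subseteq> A \<and> card T = t}"
  have "{G \<in> P. t \<le> card (G \<inter> A)} \<subseteq> (\<Union>T\<in>?I. {G \<in> P. T \<subseteq> G})"
  proof clarify
    fix G assume "G \<in> P" "t \<le> card (G \<inter> A)"
    moreover from this obtain T where "T \<subseteq> G \<inter> A" "card T = t"
      by (meson obtain_subset_with_card_n)
    ultimately show "G \<in> (\<Union>T\<in>?I. {G \<in> P. T \<subseteq> G})" by auto
  qed
  then have "card {G \<in> P. t \<le> card (G \<inter> A)} \<le> card (\<Union>T\<in>?I. {G \<in> P. T \<subseteq> G})"
    using finP finite_t_subfamilies[OF assms] by (intro card_mono) auto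
  also have "\<dots> \<le> (\<Sum>T\<in>?I. card {G \<in> P. T \<subseteq> G})"
    by (rule card_UN_le[OF finite_t_subfamilies[OF assms]])
  also have "\<dots> \<le> (\<Sum>T\<in>?I. num_partitions c (k - t))"
    using card_containing_le by (intro sum_mono) auto
  finally show ?thesis using card_t_subfamilies[OF assms] by simp
qed

text \<open>Classes with different traces \<open>T\<close> on \<open>A\<close> are disjoint, so
  their sizes add up; \<open>A\<close> itself has trace of size \<open>k > t\<close> and contributes
  the extra 1.\<close>

lemma card_neighbourhood_ge:
  assumes A: "A \<in> P" and "t < k"
    and e: "\<And>T. T \<subseteq> A \<Longrightarrow> card T = t \<Longrightarrow> e \<le> card {G \<in> P. G \<inter> A = T}"
  shows "(k choose t) * e + 1 \<le> card {G \<in> P. t \<le> card (G \<inter> A)}"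
proof -
  let ?I = "{T. T \<subseteq> A \<and> card T = t}"
  let ?U = "\<Union>T\<in>?I. {G \<in> P. G \<inter> A = T}"
  have "(k choose t) * e = (\<Sum>T\<in>?I. e)" using card_t_subfamilies[OF A] by simp
  also have "\<dots> \<le> (\<Sum>T\<in>?I. card {G \<in> P. G \<inter> A = T})" using e by (intro sum_mono) auto
  also have "\<dots> = card ?U"
    using finP finite_t_subfamilies[OF A] by (intro card_UN_disjoint[symmetric]) auto
  finally have "(k choose t) * e + 1 \<le> card ?U + 1" by simp
  also have "\<dots> = card (insert A ?U)"
    using finP finite_t_subfamilies[OF A] partition_card[OF A] assms(2) by (subst card_insert_disjoint) auto
  also have "\<dots> \<le> card {G \<in> P. t \<le> card (G \<inter> A)}"
    using finP A partition_card[OF A] assms(2) by (intro card_mono) auto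
  finally show ?thesis .
qed

text \<open>From the partitions containing \<open>T\<close>, discard those with a further block of
  \<open>A\<close>, for which there are \<open>k - t\<close> choices. The additive form avoids
  truncated subtraction.\<close>

lemma card_exact_ge:
  assumes A: "A \<in> P" and T: "T \<subseteq> A" "card T = t"
  shows "num_partitions c (k - t) \<le> card {G \<in> P. G \<inter> A = T} + (k - t) * num_partitions c (k - t - 1)"
proof -
  let ?B = "\<Union>b\<in>A - T. {G \<in> P. insert b T \<subseteq> G}"
  have fT: "finite T" using T(1) partition_finite[OF A] finite_subset by blast
  have "num_partitions c (k - t) = card {G \<in> P. T \<subseteq> G}" using card_containing[OF A T(1)] T(2) by simp
  also have "\<dots> \<le> card ({G \<in> P. G \<inter> A = T} \<union> ?B)"
    using finP partition_finite[OF A] T(1) by (intro card_mono) auto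
  also have "\<dots> \<le> card {G \<in> P. G \<inter> A = T} + card ?B" by (rule card_Un_le)
  also have "card ?B \<le> (\<Sum>b\<in>A - T. card {G \<in> P. insert b T \<subseteq> G})"
    using partition_finite[OF A] by (intro card_UN_le) simp
  also have "\<dots> \<le> (\<Sum>b\<in>A - T. num_partitions c (k - t - 1))"
  proof (rule sum_mono)
    fix b assume "b \<in> A - T"
    then show "card {G \<in> P. insert b T \<subseteq> G} \<le> num_partitions c (k - t - 1)"
      using card_containing_le[of "insert b T"] fT T(2) by simp
  qed
  also have "\<dots> = (k - t) * num_partitions c (k - t - 1)"
    using card_Diff_subset[OF fT T(1)] T(2) partition_card[OF A] by simp
  finally show ?thesis by simp
qed

text \<open>Here \<open>t + 1\<close> common blocks already force \<open>G = A\<close>, so one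
  partition is lost where \<open>card_exact_ge\<close> allows for two. The comparison for
  \<open>k = t + 2\<close> depends on this gain.\<close>

lemma card_exact_ge_two:
  assumes A: "A \<in> P" and T: "T \<subseteq> A" "card T = t" and k: "k = t + 2"
  shows "num_partitions c 2 \<le> card {G \<in> P. G \<inter> A = T} + 1"
proof -
  have "{G \<in> P. T \<subseteq> G} \<subseteq> insert A {G \<in> P. G \<inter> A = T}"
  proof
    fix G assume "G \<in> {G \<in> P. T \<subseteq> G}"
    then have G: "G \<in> P" "T \<subseteq> G" by auto
    have "G = A" if "G \<inter> A \<noteq> T"
    proof -
      have "T \<subset> G \<inter> A" using T G that by blast
      then have "t < card (G \<inter> A)"
        using T(2) partition_finite[OF A] psubset_card_mono by (metis finite_Int)
      then show "G = A" using card_common_blocks[OF G(1) A] k by force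
    qed
    then show "G \<in> insert A {G \<in> P. G \<inter> A = T}" using G by blast
  qed
  then have "card {G \<in> P. T \<subseteq> G} \<le> card (insert A {G \<in> P. G \<inter> A = T})"
    using finP by (intro card_mono) auto
  also have "\<dots> \<le> card {G \<in> P. G \<inter> A = T} + 1"
    using finP by (simp add: card_insert_if)
  finally show ?thesis using card_containing[OF A T(1)] T(2) k by simp
qed

section \<open>Partitions close to two given ones\<close>

text \<open>Count points: these blocks and the \<open>t\<close> blocks of \<open>T\<close> are
  disjoint and fit into \<open>c * k\<close> points.\<close>

lemma card_blocks_avoiding_le:
  assumes A: "A \<in> P" and T: "T \<in> uniform_families X c t"
  shows "card {b \<in> A. b \<inter> \<Union>T = {}} \<le> k - t"
proof -
  let ?D = "{b \<in> A. b \<inter> \<Union>T = {}}"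
  have D: "?D \<in> uniform_families X c (card ?D)" by (rule uniform_families_subset[OF A]) auto
  have sub: "\<Union>T \<subseteq> X" "\<Union>?D \<subseteq> X" using T D by (auto simp: uniform_families_def)
  have "card (\<Union>?D) + card (\<Union>T) = card (\<Union>?D \<union> \<Union>T)"
    using sub finX by (intro card_Un_disjoint[symmetric]) (auto intro: finite_subset)
  also have "\<dots> \<le> card X" using sub finX by (intro card_mono) auto
  finally have "c * (card ?D + t) \<le> c * k"
    using card_Union_uniform_family[OF finX D] card_Union_uniform_family[OF finX T] cardX
    by (simp add: algebra_simps)
  then show ?thesis using cpos by simp
qed

text \<open>A partition that contains \<open>T \<subseteq> A\<close> and shares \<open>card T\<close> blocks with \<open>B\<close>, where \<open>T\<close> is not inside
  \<open>B\<close>, has a further block of \<open>B\<close> which avoids \<open>\<Union>T\<close>, and at most \<open>k - t\<close> blocks of \<open>B\<close> do.\<close>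

lemma card_off_target_le:
  assumes A: "A \<in> P" and B: "B \<in> P" and T: "T \<subseteq> A" "card T = t" "\<not> T \<subseteq> B"
  shows "card {G \<in> P. T \<subseteq> G \<and> t \<le> card (G \<inter> B)} \<le> (k - t) * num_partitions c (k - t - 1)"
proof -
  let ?D = "{b \<in> B. b \<inter> \<Union>T = {}}"
  have fT: "finite T" using T(1) partition_finite[OF A] finite_subset by blast
  have TU: "T \<in> uniform_families X c t" using uniform_families_subset[OF A T(1)] T(2) by simp
  have fD: "finite ?D" using partition_finite[OF B] by simp
  \<comment> \<open>This gives \<open>insert b T\<close> its \<open>t + 1\<close> elements. A
    \<open>b\<close> in \<open>T\<close> would avoid itself, hence be empty.\<close>
  have bT: "b \<notin> T" if "b \<in> ?D" for b
  proof
    assume "b \<in> T"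
    then have "b = {}" using that by auto
    then show False using that B cpos by (auto simp: uniform_families_def)
  qed
  have "{G \<in> P. T \<subseteq> G \<and> t \<le> card (G \<inter> B)} \<subseteq> (\<Union>b\<in>?D. {G \<in> P. insert b T \<subseteq> G})"
  proof clarify
    fix G assume G: "G \<in> P" "T \<subseteq> G" "t \<le> card (G \<inter> B)"
    have "\<not> G \<inter> B \<subseteq> T"
    proof
      assume "G \<inter> B \<subseteq> T"
      then have "G \<inter> B = T" using G(3) T(2) fT by (metis card_seteq)
      then show False using T(3) by blast
    qed
    then obtain b where b: "b \<in> G" "b \<in> B" "b \<notin> T" by blast
    have "disjnt b a" if "a \<in> T" for a
    proof -
      have "pairwise disjnt G" using G(1) by (simp add: uniform_families_def)
      then show ?thesis using b that G(2) by (metis pairwiseD subsetD)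
    qed
    then have "b \<in> ?D" using b by (auto simp: disjnt_def)
    then show "G \<in> (\<Union>b\<in>?D. {G \<in> P. insert b T \<subseteq> G})" using b G by auto
  qed
  then have "card {G \<in> P. T \<subseteq> G \<and> t \<le> card (G \<inter> B)} \<le> card (\<Union>b\<in>?D. {G \<in> P. insert b T \<subseteq> G})"
    using finP fD by (intro card_mono) auto
  also have "\<dots> \<le> (\<Sum>b\<in>?D. card {G \<in> P. insert b T \<subseteq> G})" by (rule card_UN_le[OF fD])
  also have "\<dots> \<le> (\<Sum>b\<in>?D. num_partitions c (k - t - 1))"
  proof (rule sum_mono)
    fix b assume "b \<in> ?D"
    then show "card {G \<in> P. insert b T \<subseteq> G} \<le> num_partitions c (k - t - 1)"
      using card_containing_le[of "insert b T"] bT fT T(2) by simp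
  qed
  also have "\<dots> \<le> (k - t) * num_partitions c (k - t - 1)"
    using card_blocks_avoiding_le[OF B TU] by simp
  finally show ?thesis .
qed

text \<open>Each such \<open>G\<close> contains a \<open>t\<close>-subset of \<open>A\<close>. The
  \<open>S\<close> choices inside \<open>B\<close> get the trivial bound; for the others
  \<open>G\<close> needs a further block of \<open>B\<close>, which leaves at most
  \<open>q\<close>.\<close>

lemma card_common_neighbourhood_le:
  fixes t
  assumes A: "A \<in> P" and B: "B \<in> P"
  defines "S \<equiv> card (A \<inter> B) choose t"
    and "q \<equiv> (k - t) * num_partitions c (k - t - 1)"
  shows "S \<le> k choose t"
    and "card {G \<in> P. t \<le> card (G \<inter> A) \<and> t \<le> card (G \<inter> B)}
           \<le> S * num_partitions c (k - t) + ((k choose t) - S) * q"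
proof -
  let ?N = "{G \<in> P. t \<le> card (G \<inter> A) \<and> t \<le> card (G \<inter> B)}"
  let ?I = "{T. T \<subseteq> A \<and> card T = t}" and ?J = "{T. T \<subseteq> A \<inter> B \<and> card T = t}"
  let ?H = "\<lambda>T. {G \<in> P. T \<subseteq> G \<and> t \<le> card (G \<inter> B)}"
  have fI: "finite ?I" by (rule finite_t_subfamilies[OF A])
  have JI: "?J \<subseteq> ?I" by auto
  have cJ: "card ?J = S" unfolding S_def by (rule n_subsets) (simp add: partition_finite[OF A])
  show "S \<le> k choose t" using card_mono[OF fI JI] cJ card_t_subfamilies[OF A] by simp
  have cIJ: "card (?I - ?J) = (k choose t) - S"
    using card_Diff_subset[OF finite_subset[OF JI fI] JI] cJ card_t_subfamilies[OF A] by simp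
  have "?N \<subseteq> (\<Union>T\<in>?I. ?H T)"
  proof clarify
    fix G assume "G \<in> P" "t \<le> card (G \<inter> A)" "t \<le> card (G \<inter> B)"
    moreover from this obtain T where "T \<subseteq> G \<inter> A" "card T = t"
      by (meson obtain_subset_with_card_n)
    ultimately show "G \<in> (\<Union>T\<in>?I. ?H T)" by auto
  qed
  then have "card ?N \<le> card (\<Union>T\<in>?I. ?H T)" using finP fI by (intro card_mono) auto
  also have "\<dots> \<le> (\<Sum>T\<in>?I. card (?H T))" by (rule card_UN_le[OF fI])
  also have "\<dots> = (\<Sum>T\<in>?J. card (?H T)) + (\<Sum>T\<in>?I - ?J. card (?H T))"
    using sum.subset_diff[OF JI fI, of "\<lambda>T. card (?H T)"] by simp
  also have "(\<Sum>T\<in>?J. card (?H T)) \<le> (\<Sum>T\<in>?J. num_partitions c (k - t))"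
  proof (rule sum_mono)
    fix T assume T: "T \<in> ?J"
    have "card (?H T) \<le> card {G \<in> P. T \<subseteq> G}" using finP by (intro card_mono) auto
    then show "card (?H T) \<le> num_partitions c (k - t)"
      using card_containing_le[of T] T by simp
  qed
  also have "(\<Sum>T\<in>?I - ?J. card (?H T)) \<le> (\<Sum>T\<in>?I - ?J. q)"
    unfolding q_def using card_off_target_le[OF A B] by (intro sum_mono) auto
  finally show "card ?N \<le> S * num_partitions c (k - t) + ((k choose t) - S) * q"
    using cJ cIJ by simp
qed

section \<open>Comparison with the neighbourhood of one partition\<close>

text \<open>At most one \<open>t\<close>-subset of \<open>A\<close> lies in \<open>B\<close>, so
  only one of the \<open>K\<close> terms for \<open>?g\<close> is large, while all \<open>K\<close>
  terms for \<open>?N\<close> are. \<open>C\<close> is independent of the pair, since a far pair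
  need not involve the partition used as competitor.\<close>

lemma card_neighbourhood_gt_of_far_pair:
  assumes c: "c \<ge> 3" and t: "t \<ge> 1" and k: "k \<ge> t + 2"
    and C: "C \<in> P" and A: "A \<in> P" and B: "B \<in> P" and s: "card (A \<inter> B) \<le> t"
  shows "2 * card {G \<in> P. t \<le> card (G \<inter> A) \<and> t \<le> card (G \<inter> B)}
           < 1 + card {G \<in> P. t \<le> card (G \<inter> C)}" (is "2 * ?g < 1 + ?N")
proof -
  define m where "m = k - t"
  define v where "v = num_partitions c (m - 1)"
  define K where "K = k choose t"
  have m: "m \<ge> 2" using k by (simp add: m_def)
  obtain b where b: "num_partitions c m = b * v" "2 * b \<ge> (3 * m - 1) * (3 * m - 2)"
    using num_partitions_growth[OF c, of m] m by (auto simp: v_def)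
  have Kk: "K \<ge> k"
  proof -
    \<comment> \<open>Unimodality of the binomials: \<open>t\<close> lies between 1 and
      \<open>k - 1\<close>, where the value is \<open>k\<close>.\<close>
    have "k choose 1 \<le> k choose t" if "t \<le> k div 2" using t that by (intro binomial_mono) auto
    moreover have "k choose (k - 1) \<le> k choose t" if "\<not> t \<le> k div 2"
      using k that by (intro binomial_antimono) auto
    moreover have "k choose (k - 1) = k" using k binomial_symmetric[of 1 k] by simp
    ultimately show ?thesis unfolding K_def by (metis choose_one)
  qed
  have S: "card (A \<inter> B) choose t \<le> 1"
    using s by (cases "card (A \<inter> B) = t") (auto simp: binomial_eq_0)
  have g: "?g \<le> b * v + (K - 1) * (m * v)" if bm: "b \<ge> m"
  proof (cases "card (A \<inter> B) choose t = 1")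
    case True
    then show ?thesis using card_common_neighbourhood_le(2)[OF A B, of t] b(1)
      by (simp add: K_def m_def v_def)
  next
    case False
    then have "card (A \<inter> B) choose t = 0" using S by linarith
    then have "?g \<le> K * (m * v)"
      using card_common_neighbourhood_le(2)[OF A B, of t]
      by (simp add: binomial_eq_0 K_def m_def v_def)
    also have "\<dots> = m * v + (K - 1) * (m * v)" using Kk k by (cases K) auto
    also have "\<dots> \<le> b * v + (K - 1) * (m * v)" using bm by simp
    finally show ?thesis .
  qed
  show ?thesis
  proof (cases "m = 2")
    case True
    then have k2: "k = t + 2" using k by (simp add: m_def)
    have v1: "v = 1" using cpos by (simp add: v_def True)
    have b10: "b \<ge> 10" using b(2) True by simp
    have "num_partitions c 2 - 1 \<le> card {G \<in> P. G \<inter> C = T}" if "T \<subseteq> C" "card T = t" for T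
      using card_exact_ge_two[OF C that k2] by linarith
    then have "K * (b - 1) + 1 \<le> ?N"
      using card_neighbourhood_ge[OF C, of t "b - 1"] k2 b(1) v1 True unfolding K_def by simp
    moreover have "?g \<le> b + (K - 1) * 2" using g b10 True v1 by simp
    moreover obtain e where e: "b = 10 + e" using b10 le_Suc_ex by blast
    moreover obtain d where "K = 3 + d" using Kk k t le_Suc_ex[of 3 K] by auto
    \<comment> \<open>The extreme values \<open>b = 10\<close>, \<open>K = 3\<close> leave 28 < 29,
      so the 1 contributed by \<open>C\<close> is needed.\<close>
    ultimately show ?thesis by (simp add: algebra_simps)
  next
    case False
    then have m3: "m \<ge> 3" using m by simp
    \<comment> \<open>The comparison below amounts to (K - 2) b \<ge> (3 K - 2) m, and (3 K - 2) /
      (K - 2) is at most 5 for \<open>K \<ge> 4\<close>.\<close>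
    have b5: "b \<ge> 5 * m + 1"
    proof -
      obtain d where "m = 3 + d" using m3 le_Suc_ex by blast
      then show ?thesis using b(2) by (simp add: algebra_simps)
    qed
    have "b * v - m * v \<le> card {G \<in> P. G \<inter> C = T}" if "T \<subseteq> C" "card T = t" for T
      using card_exact_ge[OF C that] b(1) by (simp add: m_def v_def)
    then have N: "K * (b * v - m * v) + 1 \<le> ?N"
      using card_neighbourhood_ge[OF C, of t "b * v - m * v"] k unfolding K_def by simp
    have "2 * (b + (K - 1) * m) \<le> K * (b - m)"
    proof -
      obtain e where "b = 5 * m + 1 + e" using b5 le_Suc_ex by blast
      moreover have "K \<ge> 4" using Kk m3 t m_def by linarith
      then obtain d where "K = 4 + d" using le_Suc_ex by blast
      ultimately show ?thesis by (simp add: algebra_simps)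
    qed
    then have "2 * (b + (K - 1) * m) * v \<le> K * (b - m) * v" by (rule mult_le_mono1)
    also have "\<dots> = K * (b * v - m * v)" by (simp add: diff_mult_distrib)
    finally have "2 * (b * v + (K - 1) * (m * v)) \<le> K * (b * v - m * v)"
      by (simp add: algebra_simps)
    moreover have "?g \<le> b * v + (K - 1) * (m * v)" using g b5 by simp
    moreover have "2 * x < 1 + n" if "2 * y \<le> z" "x \<le> y" "z + 1 \<le> n" for x y z n :: nat
      using that by linarith
    ultimately show ?thesis using N by blast
  qed
qed

text \<open>With \<open>x = b - m\<close> it suffices that 2 (K - S) x \<ge> 3 m K. As
  \<open>A\<close> and \<open>B\<close> share at most \<open>k - 2\<close> blocks, S / K is at most
  (m - 1) / (m + 1), so 4 x \<ge> 3 m (m + 1) is enough, and \<open>b\<close> is large enough for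
  that.\<close>

lemma card_neighbourhood_gt_of_close_pair:
  assumes c: "c \<ge> 3" and t: "t \<ge> 1"
    and C: "C \<in> P" and A: "A \<in> P" and B: "B \<in> P" and AB: "A \<noteq> B" and s: "t < card (A \<inter> B)"
  shows "card {G \<in> P. t + 1 \<le> card (G \<inter> A)}
           + card {G \<in> P. t \<le> card (G \<inter> A) \<and> t \<le> card (G \<inter> B)}
           < 1 + card {G \<in> P. t \<le> card (G \<inter> C)}" (is "?f + ?g < 1 + ?N")
proof -
  define m where "m = k - t"
  define v where "v = num_partitions c (m - 1)"
  define K where "K = k choose t"
  define S where "S = card (A \<inter> B) choose t"
  have s2: "card (A \<inter> B) + 2 \<le> k" by (rule card_common_blocks[OF A B AB])
  have k: "k = m + t" and m: "m \<ge> 3" using s s2 by (auto simp: m_def)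
  obtain b where b: "num_partitions c m = b * v" "2 * b \<ge> (3 * m - 1) * (3 * m - 2)"
    using num_partitions_growth[OF c, of m] m by (auto simp: v_def)
  have f: "2 * ?f \<le> m * K * v"
  proof -
    \<comment> \<open>So \<open>k choose (t + 1)\<close> is m K / (t + 1), and
      \<open>t \<ge> 1\<close> gives the factor 2.\<close>
    have "(t + 1) * (k choose (t + 1)) = m * K"
      using binomial_absorb_comp[of k t] binomial_absorption[of t k]
      by (simp add: K_def m_def)
    then have "2 * (k choose (t + 1)) \<le> m * K"
      using t mult_le_mono1[of 2 "t + 1" "k choose (t + 1)"] by linarith
    then have "2 * (k choose (t + 1)) * v \<le> m * K * v" by (rule mult_le_mono1)
    moreover have "?f \<le> (k choose (t + 1)) * v"
      using card_neighbourhood_le[OF A, of "t + 1"] by (simp add: v_def m_def)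
    ultimately show ?thesis by linarith
  qed
  have SK: "S \<le> K" using card_common_neighbourhood_le(1)[OF A B] by (simp add: S_def K_def)
  have S: "(m + 1) * S \<le> (m - 1) * K"
  proof -
    define Z where "Z = (k - 2) choose t"
    have "S \<le> Z" unfolding S_def Z_def using s2 by (intro binomial_right_mono) auto
    \<comment> \<open>Two absorptions express \<open>(k - 2) choose t\<close> through
      \<open>K\<close>; then \<open>k \<ge> m + 1\<close> bounds the ratio by (m - 1) / (m +
      1).\<close>
    have Z: "k * (k - 1) * Z = m * (m - 1) * K"
    proof -
      have "(k - t) * (k choose t) = k * ((k - 1) choose t)" by (rule binomial_absorb_comp)
      moreover have "(k - 1 - t) * ((k - 1) choose t) = (k - 1) * ((k - 1 - 1) choose t)"
        by (rule binomial_absorb_comp)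
      moreover have "k - 1 - 1 = k - 2" "k - 1 - t = m - 1" by (auto simp: m_def)
      ultimately show ?thesis unfolding Z_def K_def m_def by (metis mult.assoc mult.commute)
    qed
    have "(m + 1) * m \<le> k * (k - 1)" using k t by (intro mult_le_mono) auto
    then have "(m + 1) * m * Z \<le> m * (m - 1) * K" using Z by (metis mult_le_mono1)
    then have "m * ((m + 1) * Z) \<le> m * ((m - 1) * K)" by (simp only: ac_simps)
    then have "(m + 1) * Z \<le> (m - 1) * K" using m by (subst (asm) nat_mult_le_cancel_disj) simp
    then show ?thesis using \<open>S \<le> Z\<close> by (meson le_trans mult_le_mono2)
  qed
  have g: "?g \<le> S * (b * v) + (K - S) * (m * v)"
    using card_common_neighbourhood_le(2)[OF A B, of t] b(1)
    by (simp add: S_def K_def m_def v_def)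
  have "b * v - m * v \<le> card {G \<in> P. G \<inter> C = T}" if "T \<subseteq> C" "card T = t" for T
    using card_exact_ge[OF C that] b(1) by (simp add: m_def v_def)
  then have N: "K * (b * v - m * v) + 1 \<le> ?N"
    using card_neighbourhood_ge[OF C, of t "b * v - m * v"] k m unfolding K_def by simp
  have "m * K + 2 * (S * b + (K - S) * m) \<le> 2 * (K * (b - m))"
  proof -
    \<comment> \<open>This is 4 x \<ge> 3 m (m + 1) rewritten for \<open>b = m + x\<close>.\<close>
    have b3: "4 * b \<ge> 3 * m * m + 7 * m"
    proof -
      obtain d where "m = 3 + d" using m le_Suc_ex by blast
      then show ?thesis using b(2) by (simp add: algebra_simps)
    qed
    have "m * 3 \<le> m * m" using m by simp
    then have bm: "b \<ge> m" using b3 by linarith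
    define x where "x = b - m"
    have x: "b = m + x" "3 * m * (m + 1) \<le> 4 * x" using bm b3 by (auto simp: x_def algebra_simps)
    \<comment> \<open>Multiplying by \<open>m + 1\<close> lets the bound on \<open>S\<close> enter
      without division.\<close>
    have "(m + 1) * (m * K + 2 * (S * b + (K - S) * m)) = 3 * m * (m + 1) * K + 2 * x * ((m + 1) * S)"
    proof -
      obtain r where "K = S + r" using SK le_Suc_ex by blast
      then show ?thesis using x(1) by (simp add: algebra_simps)
    qed
    also have "\<dots> \<le> 4 * x * K + 2 * x * ((m - 1) * K)"
      by (rule add_mono[OF mult_le_mono1[OF x(2)] mult_le_mono2[OF S]])
    also have "\<dots> = (m + 1) * (2 * (K * (b - m)))"
    proof -
      obtain n where "m = Suc n" using m by (cases m) auto
      then show ?thesis using x(1) by (simp add: algebra_simps)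
    qed
    finally show ?thesis by (metis Suc_eq_plus1 Suc_mult_le_cancel1)
  qed
  then have "(m * K + 2 * (S * b + (K - S) * m)) * v \<le> 2 * (K * (b - m)) * v" by (rule mult_le_mono1)
  also have "\<dots> = 2 * (K * (b * v - m * v))" by (simp add: diff_mult_distrib)
  finally have "m * K * v + 2 * (S * (b * v) + (K - S) * (m * v)) \<le> 2 * (K * (b * v - m * v))"
    by (simp add: algebra_simps)
  moreover have "x + y < 1 + n"
    if "p + 2 * q \<le> 2 * z" "2 * x \<le> p" "y \<le> q" "z + 1 \<le> n" for p q x y z n :: nat
    using that by linarith
  ultimately show ?thesis using f g N by blast
qed

section \<open>Reduction to a singleton and conclusion\<close>

text \<open>The right side is the total for the competitor \<open>{A}\<close> with its
  neighbourhood. Any two members of \<F> confine \<G> to their common neighbourhood: a far pair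
  makes twice \<open>card \<G>\<close> too small; without one, all of \<F> shares
  \<open>t + 1\<close> blocks with \<open>A\<close>.\<close>

lemma cross_intersecting_sum_less:
  assumes c: "c \<ge> 3" and t: "t \<ge> 1" and k: "k \<ge> t + 2"
    and FG: "\<F> \<subseteq> P" "\<G> \<subseteq> P" "cross_t_intersecting t \<F> \<G>" "card \<F> \<le> card \<G>"
    and AB: "A \<in> \<F>" "B \<in> \<F>" "A \<noteq> B"
  shows "card \<F> + card \<G> < 1 + card {G \<in> P. t \<le> card (G \<inter> A)}"
proof -
  have g: "card \<G> \<le> card {G \<in> P. t \<le> card (G \<inter> D) \<and> t \<le> card (G \<inter> E)}"
    if "D \<in> \<F>" "E \<in> \<F>" for D E
    using FG that finP by (intro card_mono) (auto simp: cross_t_intersecting_def Int_commute)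
  show ?thesis
  proof (cases "\<exists>D\<in>\<F>. \<exists>E\<in>\<F>. card (D \<inter> E) \<le> t")
    case True
    then obtain D E where "D \<in> \<F>" "E \<in> \<F>" "card (D \<inter> E) \<le> t" by blast
    then have "2 * card \<G> < 1 + card {G \<in> P. t \<le> card (G \<inter> A)}"
      using card_neighbourhood_gt_of_far_pair[OF c t k, of A D E] g[of D E] AB FG(1)
      by (meson le_less_trans mult_le_mono2 subsetD)
    then show ?thesis using FG(4) by linarith
  next
    case False
    then have "card \<F> \<le> card {G \<in> P. t + 1 \<le> card (G \<inter> A)}"
      using AB(1) FG(1) finP by (intro card_mono) (auto simp: not_le Suc_le_eq)
    moreover have "t < card (A \<inter> B)" using False AB by (auto simp: not_le)
    ultimately show ?thesis
      using card_neighbourhood_gt_of_close_pair[OF c t, of A A B] g[of A B] AB FG(1)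
      by (smt (verit) add_mono le_less_trans subsetD)
  qed
qed

end

theorem theorem1p3:
  fixes c k t :: nat and \<F> \<G> :: "nat set set set"
  assumes "c \<ge> 3" and "t \<ge> 1" and "k \<ge> t + 2"
    and "nonempty_cross_pair c k t \<F> \<G>"
    and "card \<F> \<le> card \<G>"
    and "\<And>\<F>' \<G>'. nonempty_cross_pair c k t \<F>' \<G>' \<Longrightarrow>
           card \<F>' + card \<G>' \<le> card \<F> + card \<G>"
    and "real c \<ge> 3 + 2 * log 2 (real t) \<or> k \<ge> 2 * t + 2"
  shows "\<exists>C \<in> uniform_partitions c k.
           \<F> = {C} \<and> \<G> = {F \<in> uniform_partitions c k. card (F \<inter> C) \<ge> t}"
proof -
  interpret partition_setting "{1..c * k}" c k
    using assms(1) by unfold_locales auto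
  have P: "uniform_partitions c k = P" by (simp add: uniform_partitions_def)
  have FG: "\<F> \<subseteq> P" "\<G> \<subseteq> P" "\<F> \<noteq> {}" "cross_t_intersecting t \<F> \<G>"
    using assms(4) by (auto simp: nonempty_cross_pair_def P)
  obtain C where C: "C \<in> \<F>" using FG(3) by blast
  define N where "N = {G \<in> P. t \<le> card (G \<inter> C)}"
  have "C \<in> N" using C FG(1) partition_card assms(3) by (auto simp: N_def)
  then have "nonempty_cross_pair c k t {C} N"
    using C FG(1) by (auto simp: nonempty_cross_pair_def P cross_t_intersecting_def N_def Int_commute)
  then have max: "1 + card N \<le> card \<F> + card \<G>" using assms(6)[of "{C}" N] by simp
  have F: "\<F> = {C}"
  proof (rule ccontr)
    assume "\<F> \<noteq> {C}"
    then obtain D where "D \<in> \<F>" "C \<noteq> D" using C by blast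
    then show False
      using cross_intersecting_sum_less[OF assms(1-3) FG(1,2,4) assms(5) C] max by (simp add: N_def)
  qed
  have "\<G> \<subseteq> N" using FG(2,4) C by (auto simp: N_def cross_t_intersecting_def Int_commute)
  moreover have "finite N" using finP by (simp add: N_def)
  \<comment> \<open>With \<open>card \<F> = 1\<close>, maximality gives
    \<open>card N \<le> card \<G>\<close>, which turns the inclusion into equality.\<close>
  ultimately have "\<G> = N" using max F by (intro card_seteq) auto
  then show ?thesis using C F FG(1) by (auto simp: P N_def)
qed

end
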